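(* Let $3 \le k \le n$ be integers. In the Counting Model of the Majority Problem with $n$ balls and query size $k$, the minimum number $A(CM,k,n)$ of queries needed in the worst case satisfies $$A(CM,k,n)\ge \frac{6n}{5k+6}-1.$$
   Context: Majority Problem, Counting Model: we are given $n$ balls, identified with $[n]=\{1,\dots,n\}$, each colored with one of two colors; the coloring is unknown to us. A query is a subset $Q\subseteq[n]$ with $|Q|=k$, and queries may be chosen adaptively (depending on previous answers). The answer to a query $Q$ is the number $i\le k/2$ such that $Q$ contains exactly $i$ balls of one color and $k-i$ balls of the other color (no information is given about which color is which). A ball $i$ is a majority ball if more than $n/2$ balls have the same color as $i$. The goal is to exhibit a majority ball, or to establish that there is none (i.e. the two color classes have equal size), with certainty for every coloring consistent with the answers. $A(CM,k,n)$ denotes the minimum, over all (adaptive) questioning strategies, of the maximum over all colorings (equivalently, against an adversary answering consistently) of the number of queries asked before the goal is reached. *)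

theory Defs
  imports Complex_Main "HOL-Library.Extended_Nat" "HOL-Library.Extended_Real"
begin

text \<open>A coloring of the balls \<open>1, \<dots>, n\<close> is a function \<open>nat \<Rightarrow> bool\<close>;
  its values outside \<open>{1..n}\<close> never matter.\<close>

type_synonym coloring = "nat \<Rightarrow> bool"

definition majority_ball :: "nat \<Rightarrow> coloring \<Rightarrow> nat \<Rightarrow> bool" where
  "majority_ball n c i \<longleftrightarrow>
     i \<in> {1..n} \<and> real (card {j \<in> {1..n}. c j = c i}) > real n / 2"

text \<open>The smaller of the two color counts is the unique \<open>i \<le> k/2\<close> such that \<open>Q\<close> has \<open>i\<close> balls of
  one color and \<open>k - i\<close> of the other.\<close>

definition answer :: "coloring \<Rightarrow> nat set \<Rightarrow> nat" where
  "answer c Q = min (card {x \<in> Q. c x}) (card {x \<in> Q. \<not> c x})"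

text \<open>Adaptive strategies are decision trees: \<open>Ask Q f\<close> queries \<open>Q\<close> and goes on with \<open>f a\<close> on
  answer \<open>a\<close>; \<open>Stop (Some i)\<close> declares \<open>i\<close> to be a majority ball, and \<open>Stop None\<close> declares that
  there is none.\<close>

datatype strategy = Stop "nat option" | Ask "nat set" "nat \<Rightarrow> strategy"

primrec valid_strategy :: "nat \<Rightarrow> nat \<Rightarrow> strategy \<Rightarrow> bool" where
  "valid_strategy k n (Stop r) = True"
| "valid_strategy k n (Ask Q f) =
     (Q \<subseteq> {1..n} \<and> card Q = k \<and> (\<forall>a. real a \<le> real k / 2 \<longrightarrow> valid_strategy k n (f a)))"

primrec verdict :: "strategy \<Rightarrow> coloring \<Rightarrow> nat option" where
  "verdict (Stop r) c = r"
| "verdict (Ask Q f) c = verdict (f (answer c Q)) c"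

primrec num_queries :: "strategy \<Rightarrow> coloring \<Rightarrow> nat" where
  "num_queries (Stop r) c = 0"
| "num_queries (Ask Q f) c = Suc (num_queries (f (answer c Q)) c)"

definition correct_verdict :: "nat \<Rightarrow> coloring \<Rightarrow> nat option \<Rightarrow> bool" where
  "correct_verdict n c r \<longleftrightarrow>
     (case r of Some i \<Rightarrow> majority_ball n c i | None \<Rightarrow> \<not> (\<exists>i. majority_ball n c i))"

text \<open>Colorings with the same answers along the tree reach the same leaf, so a correct verdict for
  every coloring means that each verdict is right for all colorings consistent with the answers.\<close>

definition solves :: "nat \<Rightarrow> nat \<Rightarrow> strategy \<Rightarrow> bool" where
  "solves k n s \<longleftrightarrow> valid_strategy k n s \<and> (\<forall>c. correct_verdict n c (verdict s c))"

text \<open>The minimal worst-case number of queries. It is \<open>\<infinity>\<close> if no strategy solves the problem, as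
  for \<open>k = n\<close>, where the only query does not tell the balls apart.\<close>

definition A_CM :: "nat \<Rightarrow> nat \<Rightarrow> enat" where
  "A_CM k n = (INF s \<in> {s. solves k n s}. SUP c. enat (num_queries s c))"

end

theory Submission
  imports Defs
begin

text \<open>The adversary fixes the color of a ball when it is queried for the second time, always pushing
  the sum of the fixed colors (\<open>1\<close> or \<open>-1\<close> each) towards \<open>0\<close>. With \<open>a = \<lfloor>k/3\<rfloor>\<close>, a new query in which
  at most \<open>a\<close> balls are fixed is answered by \<open>a\<close> and stays open: whatever the fixed colors are, its
  other balls can be completed so that either color is the minority, and as \<open>3a \<le> k\<close> one of the two
  completions does not increase the sum of the fixed colors and the other does not decrease it. Hence,
  when one more ball of an open query with \<open>a\<close> fixed balls is requested, all its balls can be fixed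
  and the sum stays between \<open>a - k\<close> and \<open>k - a\<close>. The potential, twice the number of untouched balls
  plus \<open>a - |Q \<inter> F|\<close> for every open \<open>Q\<close>, where \<open>F\<close> is the set of fixed balls, starts at \<open>2n\<close> and drops
  by at most \<open>2k - a\<close> per query. As long as it is at least \<open>2(k - a) + 2\<close>, the open queries and
  untouched balls can still turn the total sum either way, so that no verdict is safe.\<close>

section \<open>Signed color sums and answers\<close>

definition color_sum :: "coloring \<Rightarrow> nat set \<Rightarrow> int" where
  "color_sum c A = (\<Sum>x\<in>A. if c x then 1 else -1)"

lemma color_sum_eq_card:
  assumes "finite A"
  shows "color_sum c A = int (card {x \<in> A. c x}) - int (card {x \<in> A. \<not> c x})"
  using assms by (simp add: color_sum_def sum.If_cases Int_def)

lemma card_color_split: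
  assumes "finite A"
  shows "card A = card {x \<in> A. c x} + card {x \<in> A. \<not> c x}"
proof -
  have "A = {x \<in> A. c x} \<union> {x \<in> A. \<not> c x}" by auto
  then have "card A = card ({x \<in> A. c x} \<union> {x \<in> A. \<not> c x})" by simp
  also have "\<dots> = card {x \<in> A. c x} + card {x \<in> A. \<not> c x}"
    using assms by (intro card_Un_disjoint) auto
  finally show ?thesis .
qed

lemma color_sum_cong: "(\<And>x. x \<in> A \<Longrightarrow> c x = d x) \<Longrightarrow> color_sum c A = color_sum d A"
  by (simp add: color_sum_def)

lemma color_sum_Un_disjoint:
  "finite A \<Longrightarrow> finite B \<Longrightarrow> A \<inter> B = {} \<Longrightarrow> color_sum c (A \<union> B) = color_sum c A + color_sum c B"
  by (simp add: color_sum_def sum.union_disjoint)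

lemma color_sum_not: "color_sum (\<lambda>x. \<not> c x) A = - color_sum c A"
  by (auto simp: color_sum_def sum_negf[symmetric] intro!: sum.cong)

lemma abs_color_sum_le:
  assumes "finite A"
  shows "\<bar>color_sum c A\<bar> \<le> int (card A)"
  using color_sum_eq_card[OF assms, of c] card_color_split[OF assms, of c] by linarith

lemma answer_cong: "(\<And>x. x \<in> Q \<Longrightarrow> c x = d x) \<Longrightarrow> answer c Q = answer d Q"
proof -
  assume "\<And>x. x \<in> Q \<Longrightarrow> c x = d x"
  then have "{x \<in> Q. c x} = {x \<in> Q. d x}" "{x \<in> Q. \<not> c x} = {x \<in> Q. \<not> d x}" by auto
  then show ?thesis by (simp add: answer_def)
qed

lemma answer_not: "answer (\<lambda>x. \<not> c x) Q = answer c Q"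
  by (simp add: answer_def min.commute)

lemma answer_le_half:
  assumes "finite Q"
  shows "real (answer c Q) \<le> real (card Q) / 2"
  using card_color_split[OF assms, of c] by (simp add: answer_def)

text \<open>The two color classes add up to \<open>n\<close>, so exceeding half of \<open>n\<close>
  means exceeding the other class; this is the sign of the total.\<close>

lemma majority_ball_iff_color_sum:
  "majority_ball n c i \<longleftrightarrow>
     i \<in> {1..n} \<and> (if c i then color_sum c {1..n} > 0 else color_sum c {1..n} < 0)"
proof -
  have *: "color_sum c {1..n} =
      int (card {x \<in> {1..n}. c x}) - int (card {x \<in> {1..n}. \<not> c x})"
    by (rule color_sum_eq_card) simp
  have **: "n = card {x \<in> {1..n}. c x} + card {x \<in> {1..n}. \<not> c x}"
    using card_color_split[of "{1..n}" c] by simp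
  show ?thesis
    unfolding majority_ball_def * by (cases "c i") (use ** in auto)
qed

section \<open>States of the adversary and their potential\<close>

locale counting_adversary =
  fixes n k a :: nat
  assumes k_pos: "0 < k" and three_a_le: "3 * a \<le> k"
begin

text \<open>Disjointness outside \<open>F\<close> puts every unfixed ball in at most one open query,
  so open queries can be completed independently of each other.\<close>

definition state :: "nat set \<Rightarrow> nat set set \<Rightarrow> bool" where
  "state F Os \<longleftrightarrow> F \<subseteq> {1..n} \<and>
     (\<forall>Q\<in>Os. Q \<subseteq> {1..n} \<and> card Q = k \<and> card (Q \<inter> F) \<le> a) \<and>
     (\<forall>Q\<in>Os. \<forall>Q'\<in>Os. Q \<noteq> Q' \<longrightarrow> (Q - F) \<inter> (Q' - F) = {})"

definition untouched :: "nat set \<Rightarrow> nat set set \<Rightarrow> nat set" where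
  "untouched F Os = {1..n} - F - \<Union>Os"

text \<open>A summand is the number of further balls of \<open>Q\<close> that can be fixed before
  \<open>Q\<close> has to be closed. It is also a lower bound for how far completing
  \<open>Q\<close> can push the total in either direction.\<close>

definition slack :: "nat set \<Rightarrow> nat set set \<Rightarrow> int" where
  "slack F Os = (\<Sum>Q\<in>Os. int a - int (card (Q \<inter> F)))"

definition potential :: "nat set \<Rightarrow> nat set set \<Rightarrow> int" where
  "potential F Os = 2 * int (card (untouched F Os)) + slack F Os"

text \<open>Closed queries need no record: all their balls lie in \<open>F\<close>, so agreement
  with \<open>c\<close> on \<open>F\<close> determines their answers.\<close>

definition consistent :: "nat set \<Rightarrow> coloring \<Rightarrow> nat set set \<Rightarrow> coloring \<Rightarrow> bool" where
  "consistent F c Os d \<longleftrightarrow> (\<forall>x\<in>F. d x = c x) \<and> (\<forall>Q\<in>Os. answer d Q = a)"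

lemma consistent_not: "consistent F (\<lambda>x. \<not> c x) Os (\<lambda>x. \<not> d x) \<longleftrightarrow> consistent F c Os d"
  by (auto simp: consistent_def answer_not)

lemma state_finite:
  assumes "state F Os"
  shows "finite F" "finite Os" "Q \<in> Os \<Longrightarrow> finite Q"
proof -
  show "finite F" using assms by (auto simp: state_def intro: finite_subset)
  have "Os \<subseteq> Pow {1..n}" using assms by (auto simp: state_def)
  then show "finite Os" by (rule finite_subset) simp
  show "finite Q" if "Q \<in> Os"
    using assms that finite_subset[of Q "{1..n}"] by (auto simp: state_def)
qed

lemma finite_untouched [simp]: "finite (untouched F Os)"
  by (simp add: untouched_def)

lemma slack_nonneg: "state F Os \<Longrightarrow> 0 \<le> slack F Os"
  unfolding slack_def by (rule sum_nonneg) (simp add: state_def)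

lemma other_query_Int:
  assumes "state F Os" "Q \<in> Os" "Q' \<in> Os" "Q' \<noteq> Q"
  shows "Q' \<inter> (F \<union> Q) = Q' \<inter> F"
proof -
  have "(Q - F) \<inter> (Q' - F) = {}" using assms unfolding state_def by blast
  then show ?thesis by blast
qed

section \<open>Closing an open query\<close>

lemma close_query_state:
  assumes st: "state F Os" and Q: "Q \<in> Os"
  shows "state (F \<union> Q) (Os - {Q})"
    and "untouched (F \<union> Q) (Os - {Q}) = untouched F Os"
    and "slack (F \<union> Q) (Os - {Q}) = slack F Os - (int a - int (card (Q \<inter> F)))"
proof -
  note oth = other_query_Int[OF st Q]
  have "card (Q' \<inter> (F \<union> Q)) \<le> a" if "Q' \<in> Os" "Q' \<noteq> Q" for Q'
    using oth[OF that] st that(1) by (simp add: state_def)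
  then show "state (F \<union> Q) (Os - {Q})"
    using st Q unfolding state_def by blast
  show "untouched (F \<union> Q) (Os - {Q}) = untouched F Os"
    using Q by (auto simp: untouched_def)
  have "slack (F \<union> Q) (Os - {Q}) = (\<Sum>Q'\<in>Os - {Q}. int a - int (card (Q' \<inter> F)))"
    unfolding slack_def by (rule sum.cong) (use oth in auto)
  also have "\<dots> = slack F Os - (int a - int (card (Q \<inter> F)))"
    using state_finite(2)[OF st] Q by (simp add: slack_def sum_diff1)
  finally show "slack (F \<union> Q) (Os - {Q}) = slack F Os - (int a - int (card (Q \<inter> F)))" .
qed

text \<open>Here \<open>t\<close> is the intended number of \<open>True\<close> balls in
  \<open>Q\<close>. Both \<open>t\<close> and \<open>k - t\<close> are at least \<open>a\<close>,
  hence at least the number of fixed balls of either color in \<open>Q\<close>, so the unfixed balls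
  can make up the difference.\<close>

lemma close_query_coloring:
  assumes st: "state F Os" and Q: "Q \<in> Os" and t: "t = a \<or> t = k - a"
  obtains d where
    "\<And>e. consistent (F \<union> Q) d (Os - {Q}) e \<Longrightarrow> consistent F c Os e"
    "color_sum d (F \<union> Q) = color_sum c F + (2 * int t - int k) - color_sum c (Q \<inter> F)"
proof -
  note fin = state_finite(1)[OF st] state_finite(3)[OF st Q]
  have ca: "card Q = k" and le: "card (Q \<inter> F) \<le> a"
    using st Q by (auto simp: state_def)
  define r where "r = card {x \<in> Q \<inter> F. c x}"
  have r: "r \<le> card (Q \<inter> F)"
    unfolding r_def using fin by (intro card_mono) auto
  have cd: "card (Q - F) = k - card (Q \<inter> F)"
    using ca fin by (metis card_Diff_subset_Int finite_Int)
  have "t - r \<le> card (Q - F)"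
    using t le r cd three_a_le by auto
  then obtain A where A: "A \<subseteq> Q - F" "card A = t - r"
    by (metis obtain_subset_with_card_n)
  \<comment> \<open>The value \<open>False\<close> outside \<open>F \<union> Q\<close> is a mere
    default, as \<open>consistent\<close> reads \<open>d\<close> on \<open>F \<union> Q\<close>
    only.\<close>
  define d where "d x = (if x \<in> F then c x else x \<in> A)" for x
  have eq: "{x \<in> Q. d x} = {x \<in> Q \<inter> F. c x} \<union> A"
    using A by (auto simp: d_def)
  have "card {x \<in> Q. d x} = r + (t - r)"
    unfolding eq r_def A(2)[symmetric, unfolded r_def]
    by (rule card_Un_disjoint) (use A fin finite_subset[of A Q] in auto)
  then have red: "card {x \<in> Q. d x} = t"
    using r le t three_a_le by auto
  have tk: "t \<le> k" using t three_a_le by auto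
  have blue: "card {x \<in> Q. \<not> d x} = k - t"
    using card_color_split[OF fin(2), of d] red ca by simp
  have ans: "answer d Q = a"
    unfolding answer_def red blue using t three_a_le by auto
  show thesis
  proof (rule that)
    show "consistent F c Os e" if e: "consistent (F \<union> Q) d (Os - {Q}) e" for e
    proof -
      have "answer e Q = a"
        unfolding ans[symmetric] by (rule answer_cong) (use e in \<open>simp add: consistent_def\<close>)
      then show ?thesis using e by (auto simp: consistent_def d_def)
    qed
    have "color_sum d Q = color_sum d (Q \<inter> F) + color_sum d (Q - F)"
      using color_sum_Un_disjoint[of "Q \<inter> F" "Q - F" d] fin by (simp add: Int_Diff_Un Int_Diff_disjoint)
    moreover have "color_sum d Q = 2 * int t - int k"
      using color_sum_eq_card[OF fin(2), of d] red blue tk by simp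
    moreover have "color_sum d (Q \<inter> F) = color_sum c (Q \<inter> F)" "color_sum d F = color_sum c F"
      by (auto intro!: color_sum_cong simp: d_def)
    moreover have "color_sum d (F \<union> Q) = color_sum d F + color_sum d (Q - F)"
      using color_sum_Un_disjoint[of F "Q - F" d] fin by simp
    ultimately show "color_sum d (F \<union> Q) = color_sum c F + (2 * int t - int k) - color_sum c (Q \<inter> F)"
      by simp
  qed
qed

section \<open>Fixing requested balls\<close>

text \<open>A ball in an open query that already has \<open>a\<close> fixed balls forces this query
  to be closed, which is free because its slack is 0. Any other unfixed ball is colored alone,
  against the sign of the sum, and costs 2 if untouched and 1 if it lies in an open query.\<close>

lemma fix_ball:
  assumes st: "state F Os" and bal: "\<bar>color_sum c F\<bar> \<le> int k - int a" and b: "b \<in> {1..n}"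
  obtains F' Os' d where
    "state F' Os'" "\<bar>color_sum d F'\<bar> \<le> int k - int a" "F \<subseteq> F'" "b \<in> F'"
    "untouched F' Os' = untouched F Os - {b}"
    "\<And>e. consistent F' d Os' e \<Longrightarrow> consistent F c Os e"
    "potential F' Os' \<ge> potential F Os - (if b \<in> untouched F Os then 2 else 1)"
proof (cases "b \<in> F")
  case True
  then show thesis
    using that[OF st bal] by (auto simp: untouched_def)
next
  case False
  note fin = state_finite[OF st]
  \<comment> \<open>From sum 0 a single ball leads to -1, so the bound has to be at least 1.\<close>
  have ka: "int k - int a \<ge> 1" using k_pos three_a_le by auto
  show thesis
  proof (cases "\<exists>Q\<in>Os. b \<in> Q \<and> card (Q \<inter> F) = a")
    case True
    then obtain Q where Q: "Q \<in> Os" "b \<in> Q" "card (Q \<inter> F) = a" by blast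
    have q: "\<bar>color_sum c (Q \<inter> F)\<bar> \<le> int a"
      using abs_color_sum_le[of "Q \<inter> F" c] fin(1) Q(3) by simp
    \<comment> \<open>For a nonnegative sum, \<open>t = a\<close> changes it by
      \<open>2a - k\<close> minus a number in \<open>[-a, a]\<close>, that is by something between
      \<open>-(k - a)\<close> and \<open>3a - k \<le> 0\<close>. The other case is
      symmetric.\<close>
    define t where "t = (if color_sum c F \<ge> 0 then a else k - a)"
    have "t = a \<or> t = k - a" by (simp add: t_def)
    from close_query_coloring[OF st Q(1) this]
    obtain d where d: "\<And>e. consistent (F \<union> Q) d (Os - {Q}) e \<Longrightarrow> consistent F c Os e"
      "color_sum d (F \<union> Q) = color_sum c F + (2 * int t - int k) - color_sum c (Q \<inter> F)"
      by blast
    note cl = close_query_state[OF st Q(1)]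
    show thesis
    proof (rule that[of "F \<union> Q" "Os - {Q}" d])
      show "state (F \<union> Q) (Os - {Q})" by (rule cl(1))
      show "\<bar>color_sum d (F \<union> Q)\<bar> \<le> int k - int a"
        using bal q d(2) three_a_le by (auto simp: t_def of_nat_diff split: if_splits)
      show "untouched (F \<union> Q) (Os - {Q}) = untouched F Os - {b}"
        using cl(2) Q by (auto simp: untouched_def)
      show "potential (F \<union> Q) (Os - {Q}) \<ge> potential F Os - (if b \<in> untouched F Os then 2 else 1)"
        using cl Q by (simp add: potential_def)
    qed (use Q d in auto)
  next
    case no: False
    define d where "d = c(b := color_sum c F < 0)"
    have dF: "color_sum d F = color_sum c F"
      by (rule color_sum_cong) (use False in \<open>auto simp: d_def\<close>)
    have "color_sum d (insert b F) = color_sum c F + (if color_sum c F < 0 then 1 else -1)"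
      using fin(1) False dF by (simp add: color_sum_def d_def)
    then have bal': "\<bar>color_sum d (insert b F)\<bar> \<le> int k - int a"
      using bal ka by auto
    have ins: "Q \<inter> insert b F = (if b \<in> Q then insert b (Q \<inter> F) else Q \<inter> F)" for Q by auto
    have cins: "card (Q \<inter> insert b F) = card (Q \<inter> F) + (if b \<in> Q then 1 else 0)" for Q
      using fin(1) False by (simp add: ins)
    have "card (Q \<inter> insert b F) \<le> a" if "Q \<in> Os" for Q
    proof -
      have "card (Q \<inter> F) \<le> a" using st that by (simp add: state_def)
      moreover have "b \<in> Q \<Longrightarrow> card (Q \<inter> F) \<noteq> a" using no that by blast
      ultimately show ?thesis unfolding cins by auto
    qed
    moreover have "(Q - insert b F) \<inter> (Q' - insert b F) = {}"
      if "Q \<in> Os" "Q' \<in> Os" "Q \<noteq> Q'" for Q Q'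
    proof -
      have "(Q - F) \<inter> (Q' - F) = {}" using st that by (simp add: state_def)
      then show ?thesis by blast
    qed
    ultimately have st': "state (insert b F) Os"
      using st b by (simp add: state_def)
    have un: "untouched (insert b F) Os = untouched F Os - {b}"
      by (auto simp: untouched_def)
    have "slack (insert b F) Os = (\<Sum>Q\<in>Os. (int a - int (card (Q \<inter> F))) - (if b \<in> Q then 1 else 0))"
      unfolding slack_def cins by (rule sum.cong) auto
    also have "\<dots> = slack F Os - int (card {Q \<in> Os. b \<in> Q})"
      unfolding sum_subtractf slack_def using fin(2) by (simp add: sum.If_cases Int_def)
    finally have sl: "slack (insert b F) Os = slack F Os - int (card {Q \<in> Os. b \<in> Q})" .
    have pot: "potential (insert b F) Os \<ge> potential F Os - (if b \<in> untouched F Os then 2 else 1)"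
    proof (cases "b \<in> untouched F Os")
      case True
      then have "{Q \<in> Os. b \<in> Q} = {}" by (auto simp: untouched_def)
      then have "card {Q \<in> Os. b \<in> Q} = 0" by (simp only: card.empty)
      moreover have "card (untouched F Os) = Suc (card (untouched F Os - {b}))"
        using True by (metis card_Suc_Diff1 finite_untouched)
      ultimately show ?thesis using sl un True by (simp add: potential_def)
    next
      case nb: False
      \<comment> \<open>By disjointness outside \<open>F\<close>, only one open query can lose
        slack.\<close>
      have "Q = Q'" if "Q \<in> Os" "Q' \<in> Os" "b \<in> Q" "b \<in> Q'" for Q Q'
        using st that False unfolding state_def by blast
      then have "\<forall>Q\<in>{Q \<in> Os. b \<in> Q}. \<forall>Q'\<in>{Q \<in> Os. b \<in> Q}. Q = Q'" by blast
      then have "card {Q \<in> Os. b \<in> Q} \<le> 1"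
        using fin(2) card_le_Suc0_iff_eq[of "{Q \<in> Os. b \<in> Q}"] by simp
      then show ?thesis using sl un nb by (simp add: potential_def)
    qed
    show thesis
    proof (rule that[OF st' bal' _ _ un _ pot])
      show "consistent F c Os e" if "consistent (insert b F) d Os e" for e
        using that False by (auto simp: consistent_def d_def)
    qed auto
  qed
qed

lemma fix_balls:
  assumes "finite B" "B \<subseteq> {1..n}" and st: "state F Os" and bal: "\<bar>color_sum c F\<bar> \<le> int k - int a"
  shows "\<exists>F' d Os'. state F' Os' \<and> \<bar>color_sum d F'\<bar> \<le> int k - int a \<and> B \<subseteq> F' \<and>
    untouched F' Os' = untouched F Os - B \<and>
    (\<forall>e. consistent F' d Os' e \<longrightarrow> consistent F c Os e) \<and>
    potential F' Os' \<ge>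
      potential F Os - 2 * int (card (B \<inter> untouched F Os)) - int (card (B - untouched F Os))"
  using assms(1,2)
proof (induction B)
  case empty
  then show ?case using st bal by (intro exI[of _ F] exI[of _ c] exI[of _ Os]) simp
next
  case (insert b B)
  from insert.IH insert.prems obtain F1 d1 Os1 where s1: "state F1 Os1"
    "\<bar>color_sum d1 F1\<bar> \<le> int k - int a" "B \<subseteq> F1"
    "untouched F1 Os1 = untouched F Os - B"
    "\<forall>e. consistent F1 d1 Os1 e \<longrightarrow> consistent F c Os e"
    "potential F1 Os1 \<ge>
      potential F Os - 2 * int (card (B \<inter> untouched F Os)) - int (card (B - untouched F Os))"
    by auto
  have b: "b \<in> {1..n}" using insert.prems by simp
  obtain F2 d2 Os2 where s2: "state F2 Os2"
    "\<bar>color_sum d2 F2\<bar> \<le> int k - int a" "F1 \<subseteq> F2" "b \<in> F2"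
    "untouched F2 Os2 = untouched F1 Os1 - {b}"
    "\<And>e. consistent F2 d2 Os2 e \<Longrightarrow> consistent F1 d1 Os1 e"
    "potential F2 Os2 \<ge> potential F1 Os1 - (if b \<in> untouched F1 Os1 then 2 else 1)"
    by (rule fix_ball[OF s1(1,2) b]) (rule that)
  \<comment> \<open>Each step removes only its own ball from the untouched set, so every ball can be
    charged according to the initial state.\<close>
  have iff: "b \<in> untouched F1 Os1 \<longleftrightarrow> b \<in> untouched F Os"
    using s1(4) insert.hyps by auto
  have "potential F2 Os2 \<ge> potential F Os - 2 * int (card (insert b B \<inter> untouched F Os))
      - int (card (insert b B - untouched F Os))"
    using s2(7) s1(6) insert.hyps unfolding iff
    by (cases "b \<in> untouched F Os") (simp_all add: insert_Diff_if)
  moreover have "untouched F2 Os2 = untouched F Os - insert b B"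
    using s2(5) s1(4) by auto
  ultimately show ?case
    using s1 s2 by (intro exI[of _ F2] exI[of _ d2] exI[of _ Os2]) auto
qed

section \<open>Answering a query\<close>

text \<open>Let \<open>R\<close> be the touched balls of \<open>Q\<close>. If
  \<open>|R| \<le> a\<close>, fixing \<open>R\<close> costs at most \<open>|R|\<close>, touching the
  rest costs \<open>2(k - |R|)\<close>, and the new open query returns slack \<open>a - |R|\<close>:
  at most \<open>2k - a\<close> in all. Otherwise fixing all of \<open>Q\<close> costs at most
  \<open>2k - |R| < 2k - a\<close>.\<close>

lemma answer_query:
  assumes st: "state F Os" and bal: "\<bar>color_sum c F\<bar> \<le> int k - int a"
    and Q: "Q \<subseteq> {1..n}" "card Q = k"
  obtains F' Os' d r where
    "state F' Os'" "\<bar>color_sum d F'\<bar> \<le> int k - int a"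
    "\<And>e. consistent F' d Os' e \<Longrightarrow> consistent F c Os e \<and> answer e Q = r"
    "potential F' Os' \<ge> potential F Os - (2 * int k - int a)"
proof -
  define R where "R = Q - untouched F Os"
  have finQ: "finite Q" using Q(1) by (rule finite_subset) simp
  then have finR: "finite R" by (simp add: R_def)
  have QR: "card Q = card (Q \<inter> untouched F Os) + card R"
    unfolding R_def using finQ by (metis card_Int_Diff)
  show thesis
  proof (cases "card R \<le> a")
    case True
    have "R \<subseteq> {1..n}" using Q by (auto simp: R_def)
    from fix_balls[OF finR this st bal] obtain F1 d1 Os1 where s1: "state F1 Os1"
      "\<bar>color_sum d1 F1\<bar> \<le> int k - int a" "R \<subseteq> F1"
      "untouched F1 Os1 = untouched F Os - R"
      "\<forall>e. consistent F1 d1 Os1 e \<longrightarrow> consistent F c Os e"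
      "potential F1 Os1 \<ge>
        potential F Os - 2 * int (card (R \<inter> untouched F Os)) - int (card (R - untouched F Os))"
      by blast
    have R0: "R \<inter> untouched F Os = {}" "R - untouched F Os = R" by (auto simp: R_def)
    have un1: "untouched F1 Os1 = untouched F Os" using s1(4) R0 by blast
    \<comment> \<open>Fixing \<open>R\<close> may close further queries, but these contain no
      untouched balls, so no ball of \<open>Q\<close> outside \<open>R\<close> gets fixed.\<close>
    have QF: "Q \<inter> F1 = R"
      using s1(3) un1 by (auto simp: R_def untouched_def)
    have QU: "Q - F1 \<subseteq> untouched F1 Os1"
      using QF un1 by (auto simp: R_def)
    \<comment> \<open>Only a new member of the set of open queries adds a summand to the
      slack.\<close>
    have new: "Q \<notin> Os1"
    proof
      assume "Q \<in> Os1"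
      then have "Q - F1 = {}" using QU by (auto simp: untouched_def)
      then have "R = Q" using QF by auto
      then show False using True Q(2) three_a_le k_pos by auto
    qed
    have st': "state F1 (insert Q Os1)"
    proof -
      have "(Q - F1) \<inter> (Q' - F1) = {}" if "Q' \<in> Os1" for Q'
        using QU that by (auto simp: untouched_def)
      then show ?thesis
        using s1(1) Q QF True unfolding state_def by (auto simp: Int_commute)
    qed
    have "untouched F1 (insert Q Os1) = untouched F Os - (Q \<inter> untouched F Os)"
      unfolding un1[symmetric] by (auto simp: untouched_def)
    then have "int (card (untouched F1 (insert Q Os1))) =
        int (card (untouched F Os)) - int (card (Q \<inter> untouched F Os))"
      using finQ by (simp add: card_Diff_subset card_mono of_nat_diff)
    moreover have "slack F1 (insert Q Os1) = slack F1 Os1 + int a - int (card R)"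
      using new state_finite(2)[OF s1(1)] QF by (simp add: slack_def)
    ultimately have pot: "potential F1 (insert Q Os1) \<ge> potential F Os - (2 * int k - int a)"
      using s1(6) un1 R0 QR Q(2) by (simp add: potential_def)
    show thesis
    proof (rule that[OF st' s1(2) _ pot, of a])
      show "consistent F c Os e \<and> answer e Q = a"
        if "consistent F1 d1 (insert Q Os1) e" for e
        using that s1(5) by (auto simp: consistent_def)
    qed
  next
    case False
    from fix_balls[OF finQ Q(1) st bal] obtain F1 d1 Os1 where s1: "state F1 Os1"
      "\<bar>color_sum d1 F1\<bar> \<le> int k - int a" "Q \<subseteq> F1"
      "\<forall>e. consistent F1 d1 Os1 e \<longrightarrow> consistent F c Os e"
      "potential F1 Os1 \<ge>
        potential F Os - 2 * int (card (Q \<inter> untouched F Os)) - int (card R)"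
      unfolding R_def by blast
    have pot: "potential F1 Os1 \<ge> potential F Os - (2 * int k - int a)"
      using s1(5) QR Q(2) False by linarith
    show thesis
    proof (rule that[OF s1(1,2) _ pot, of "answer d1 Q"])
      show "consistent F c Os e \<and> answer e Q = answer d1 Q"
        if e: "consistent F1 d1 Os1 e" for e
      proof
        show "answer e Q = answer d1 Q"
          by (rule answer_cong) (use e s1(3) in \<open>auto simp: consistent_def\<close>)
      qed (use e s1(4) in blast)
    qed
  qed
qed

section \<open>Extreme completions and refuted verdicts\<close>

text \<open>Open queries are closed one by one with \<open>t = a\<close>. With \<open>f\<close>
  fixed balls in \<open>Q\<close> this lowers the sum by at least
  \<open>k - 2a - f \<ge> a - f\<close>, the slack of \<open>Q\<close>. Untouched balls all become
  \<open>False\<close>.\<close>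

lemma completion_low:
  assumes "state F Os"
  shows "\<exists>e. consistent F c Os e \<and>
    color_sum e {1..n} \<le> color_sum c F - int (card (untouched F Os)) - slack F Os"
  using assms
proof (induction "card Os" arbitrary: F c Os)
  case 0
  then have Os: "Os = {}" using state_finite(2)[OF 0(2)] by simp
  have F: "F \<subseteq> {1..n}" using 0(2) by (simp add: state_def)
  define e where "e x = (x \<in> F \<and> c x)" for x
  have "color_sum e {1..n} = color_sum e F + color_sum e ({1..n} - F)"
    using color_sum_Un_disjoint[of F "{1..n} - F" e] F state_finite(1)[OF 0(2)]
    by (simp add: Un_absorb1)
  moreover have "color_sum e F = color_sum c F"
    by (rule color_sum_cong) (simp add: e_def)
  moreover have "color_sum e ({1..n} - F) = - int (card ({1..n} - F))"
    by (simp add: color_sum_def e_def)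
  ultimately have "consistent F c Os e \<and>
      color_sum e {1..n} \<le> color_sum c F - int (card (untouched F Os)) - slack F Os"
    by (simp add: Os consistent_def untouched_def slack_def e_def)
  then show ?case by blast
next
  case (Suc m)
  note st = Suc.prems
  from Suc.hyps(2) obtain Q where Q: "Q \<in> Os" by (metis card.empty equals0I nat.distinct(1))
  note cl = close_query_state[OF st Q]
  obtain d where d: "\<And>e. consistent (F \<union> Q) d (Os - {Q}) e \<Longrightarrow> consistent F c Os e"
    "color_sum d (F \<union> Q) = color_sum c F + (2 * int a - int k) - color_sum c (Q \<inter> F)"
    using close_query_coloring[OF st Q, of a c] by blast
  have "m = card (Os - {Q})" using Suc.hyps(2) Q by simp
  from Suc.hyps(1)[OF this cl(1), of d] obtain e where e:
    "consistent (F \<union> Q) d (Os - {Q}) e"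
    "color_sum e {1..n} \<le> color_sum d (F \<union> Q) - int (card (untouched (F \<union> Q) (Os - {Q})))
      - slack (F \<union> Q) (Os - {Q})"
    by blast
  have "\<bar>color_sum c (Q \<inter> F)\<bar> \<le> int (card (Q \<inter> F))"
    using state_finite(1)[OF st] by (intro abs_color_sum_le) simp
  then have "color_sum e {1..n} \<le> color_sum c F - int (card (untouched F Os)) - slack F Os"
    using e(2) three_a_le unfolding cl(2,3) d(2) by linarith
  then show ?case using d(1)[OF e(1)] by blast
qed

text \<open>Swapping the colors preserves all answers and negates sums.\<close>

lemma completion_high:
  assumes "state F Os"
  shows "\<exists>e. consistent F c Os e \<and>
    color_sum e {1..n} \<ge> color_sum c F + int (card (untouched F Os)) + slack F Os"
proof -
  obtain e where e: "consistent F (\<lambda>x. \<not> c x) Os e"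
    "color_sum e {1..n} \<le> color_sum (\<lambda>x. \<not> c x) F - int (card (untouched F Os)) - slack F Os"
    using completion_low[OF assms] by blast
  have "consistent F c Os (\<lambda>x. \<not> e x)"
    using e(1) consistent_not[of F c Os "\<lambda>x. \<not> e x"] by simp
  moreover have "color_sum (\<lambda>x. \<not> e x) {1..n} \<ge> color_sum c F + int (card (untouched F Os)) + slack F Os"
    using e(2) by (simp add: color_sum_not)
  ultimately show ?thesis by blast
qed

text \<open>As the slack is nonnegative, half the potential bounds the reach of the completions from
  below. The extra 2 gives a strict sign against \<open>None\<close>, and against
  \<open>Some b\<close> it pays for fixing \<open>b\<close>.\<close>

lemma verdict_refuted:
  assumes st: "state F Os" and bal: "\<bar>color_sum c F\<bar> \<le> int k - int a"
    and pot: "potential F Os \<ge> 2 * (int k - int a) + 2"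
  shows "\<exists>e. consistent F c Os e \<and> \<not> correct_verdict n e v"
proof (cases v)
  case None
  obtain e where e: "consistent F c Os e"
    "color_sum e {1..n} \<le> color_sum c F - int (card (untouched F Os)) - slack F Os"
    using completion_low[OF st] by blast
  have "color_sum e {1..n} < 0"
    using e(2) pot bal slack_nonneg[OF st] by (simp add: potential_def)
  \<comment> \<open>A negative total requires some \<open>False\<close> ball, which is then a
    majority ball.\<close>
  moreover have "color_sum e {1..n} \<ge> 0" if "\<forall>i\<in>{1..n}. e i"
    unfolding color_sum_def by (rule sum_nonneg) (use that in auto)
  ultimately obtain i where "color_sum e {1..n} < 0" "i \<in> {1..n}" "\<not> e i"
    by fastforce
  then have "majority_ball n e i" by (simp add: majority_ball_iff_color_sum)
  then show ?thesis using e(1) None by (auto simp: correct_verdict_def)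
next
  case (Some b)
  show ?thesis
  proof (cases "b \<in> {1..n}")
    case True
    obtain F' d Os' where s: "state F' Os'" "\<bar>color_sum d F'\<bar> \<le> int k - int a" "F \<subseteq> F'" "b \<in> F'"
      "untouched F' Os' = untouched F Os - {b}"
      "\<And>e. consistent F' d Os' e \<Longrightarrow> consistent F c Os e"
      "potential F' Os' \<ge> potential F Os - (if b \<in> untouched F Os then 2 else 1)"
      by (rule fix_ball[OF st bal True]) (rule that)
    have pot': "potential F' Os' \<ge> 2 * (int k - int a)"
      using s(7) pot by (simp split: if_splits)
    \<comment> \<open>The color of \<open>b\<close> is now settled, and the total is pushed against
      it; reaching 0 suffices, since a majority is strict.\<close>
    have "\<exists>e. consistent F' d Os' e \<and> \<not> majority_ball n e b"
    proof (cases "d b")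
      case True
      obtain e where e: "consistent F' d Os' e"
        "color_sum e {1..n} \<le> color_sum d F' - int (card (untouched F' Os')) - slack F' Os'"
        using completion_low[OF s(1)] by blast
      have "color_sum e {1..n} \<le> 0"
        using e(2) pot' s(2) slack_nonneg[OF s(1)] by (simp add: potential_def)
      moreover have "e b" using e(1) True s(4) by (simp add: consistent_def)
      ultimately have "\<not> majority_ball n e b" by (simp add: majority_ball_iff_color_sum)
      then show ?thesis using e(1) by blast
    next
      case False
      obtain e where e: "consistent F' d Os' e"
        "color_sum e {1..n} \<ge> color_sum d F' + int (card (untouched F' Os')) + slack F' Os'"
        using completion_high[OF s(1)] by blast
      have "color_sum e {1..n} \<ge> 0"
        using e(2) pot' s(2) slack_nonneg[OF s(1)] by (simp add: potential_def)
      moreover have "\<not> e b" using e(1) False s(4) by (simp add: consistent_def)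
      ultimately have "\<not> majority_ball n e b" by (simp add: majority_ball_iff_color_sum)
      then show ?thesis using e(1) by blast
    qed
    then show ?thesis using s(6) Some by (auto simp: correct_verdict_def)
  next
    case False
    then show ?thesis
      using completion_low[OF st, of c] Some by (auto simp: correct_verdict_def majority_ball_def)
  qed
qed

section \<open>Counting the queries\<close>

text \<open>Induction along the branch that the adversary selects: each query costs at most
  \<open>2k - a\<close>, and at a leaf the potential must be too small to refute the verdict.
  Correctness is assumed only for consistent colorings, so it passes to the subtree.\<close>

lemma potential_less_num_queries:
  assumes "state F Os" "\<bar>color_sum c F\<bar> \<le> int k - int a" "valid_strategy k n s"
    and "\<And>e. consistent F c Os e \<Longrightarrow> correct_verdict n e (verdict s e)"
  shows "\<exists>e. consistent F c Os e \<and>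
    potential F Os < (2 * int k - int a) * int (num_queries s e) + 2 * (int k - int a) + 2"
  using assms
proof (induction s arbitrary: F c Os)
  case (Stop v)
  have "\<not> potential F Os \<ge> 2 * (int k - int a) + 2"
    using verdict_refuted[OF Stop(1,2), of v] Stop(4) by auto
  then show ?case using completion_low[OF Stop(1), of c] by auto
next
  case (Ask Q f)
  from Ask.prems(3) have Q: "Q \<subseteq> {1..n}" "card Q = k"
    and val: "\<And>r. real r \<le> real k / 2 \<Longrightarrow> valid_strategy k n (f r)" by auto
  obtain F' d Os' r where s: "state F' Os'" "\<bar>color_sum d F'\<bar> \<le> int k - int a"
    "\<And>e. consistent F' d Os' e \<Longrightarrow> consistent F c Os e \<and> answer e Q = r"
    "potential F' Os' \<ge> potential F Os - (2 * int k - int a)"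
    by (rule answer_query[OF Ask.prems(1,2) Q]) (rule that)
  \<comment> \<open>Subtrees are known to be valid only for answers up to \<open>k / 2\<close>; a
    coloring that realizes \<open>r\<close> shows that \<open>r\<close> is one of them.\<close>
  obtain e0 where "consistent F' d Os' e0" using completion_low[OF s(1)] by blast
  then have "real r \<le> real k / 2"
    using s(3) answer_le_half[of Q e0] Q finite_subset[of Q "{1..n}"] by auto
  then have v: "valid_strategy k n (f r)" by (rule val)
  have "correct_verdict n e (verdict (f r) e)" if "consistent F' d Os' e" for e
    using Ask.prems(4)[of e] s(3)[OF that] by auto
  from Ask.IH[OF rangeI s(1,2) v this] obtain e where e: "consistent F' d Os' e"
    "potential F' Os' < (2 * int k - int a) * int (num_queries (f r) e) + 2 * (int k - int a) + 2"
    by blast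
  have "num_queries (Ask Q f) e = Suc (num_queries (f r) e)" using s(3)[OF e(1)] by simp
  then have "potential F Os <
      (2 * int k - int a) * int (num_queries (Ask Q f) e) + 2 * (int k - int a) + 2"
    using e(2) s(4) by (simp add: algebra_simps)
  then show ?case using s(3)[OF e(1)] by blast
qed

lemma solves_num_queries:
  assumes "solves k n s"
  shows "\<exists>e. 2 * int n < (2 * int k - int a) * int (num_queries s e) + 2 * (int k - int a) + 2"
proof -
  have "state {} {}" by (simp add: state_def)
  moreover have "\<bar>color_sum c {}\<bar> \<le> int k - int a" for c
    using three_a_le by (simp add: color_sum_def)
  ultimately have "\<exists>e. potential {} {} <
      (2 * int k - int a) * int (num_queries s e) + 2 * (int k - int a) + 2"
    using potential_less_num_queries[of "{}" "{}" _ s] assms by (fastforce simp: solves_def)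
  then show ?thesis by (simp add: potential_def untouched_def slack_def)
qed

end

theorem theorem5:
  fixes k n :: nat
  assumes "3 \<le> k" and "k \<le> n"
  shows "ereal (6 * real n / (5 * real k + 6) - 1) \<le> ereal_of_enat (A_CM k n)"
proof -
  \<comment> \<open>The cost \<open>2k - a\<close> decreases in \<open>a\<close>, so the largest
    value with \<open>3a \<le> k\<close> is taken.\<close>
  define a where "a = k div 3"
  interpret counting_adversary n k a
    by unfold_locales (use assms in \<open>auto simp: a_def\<close>)
  have a: "int k \<le> 3 * int a + 2" "1 \<le> a"
    using assms unfolding a_def by linarith+
  \<comment> \<open>Rounding up gives a natural number to compare within \<open>enat\<close>;
    \<open>nat\<close> turns a negative bound into 0.\<close>
  define m where "m = nat \<lceil>6 * real n / (5 * real k + 6) - 1\<rceil>"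
  have "enat m \<le> (SUP c. enat (num_queries s c))" if sol: "solves k n s" for s
  proof -
    obtain e where e: "2 * int n < (2 * int k - int a) * int (num_queries s e) + 2 * (int k - int a) + 2"
      using solves_num_queries[OF sol] by blast
    let ?q = "num_queries s e"
    have "3 * (2 * int k - int a) \<le> 5 * int k + 6"
      using a by presburger
    then have "3 * (2 * int k - int a) * int ?q \<le> (5 * int k + 6) * int ?q"
      by (rule mult_right_mono) simp
    \<comment> \<open>This amounts to \<open>k \<le> 6a\<close>, which follows from
      \<open>k \<le> 3a + 2\<close> and \<open>a \<ge> 1\<close>.\<close>
    moreover have "6 * (int k - int a) + 6 \<le> 5 * int k + 6"
      using a by presburger
    moreover have "3 * ((2 * int k - int a) * int ?q) = 3 * (2 * int k - int a) * int ?q"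
      by simp
    ultimately have "6 * int n \<le> (5 * int k + 6) * int ?q + (5 * int k + 6)"
      using e by linarith
    then have "int (6 * n) \<le> int ((5 * k + 6) * (?q + 1))" by (simp add: algebra_simps)
    then have "6 * n \<le> (5 * k + 6) * (?q + 1)" by (simp only: of_nat_le_iff)
    then have "real (6 * n) \<le> real ((5 * k + 6) * (?q + 1))" by (simp only: of_nat_le_iff)
    then have "6 * real n / (5 * real k + 6) \<le> real ?q + 1"
      by (simp add: field_simps)
    then have "m \<le> ?q" unfolding m_def by linarith
    then show ?thesis by (meson SUP_upper2 UNIV_I enat_ord_simps(1))
  qed
  then have "enat m \<le> A_CM k n"
    unfolding A_CM_def by (auto intro!: INF_greatest)
  then have "ereal_of_enat (enat m) \<le> ereal_of_enat (A_CM k n)"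
    by (simp only: ereal_of_enat_le_iff)
  moreover have "ereal (6 * real n / (5 * real k + 6) - 1) \<le> ereal (real m)"
    unfolding m_def ereal_less_eq(3) by (rule real_nat_ceiling_ge)
  ultimately show ?thesis
    by (metis ereal_of_enat_simps(1) order_trans)
qed

end
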